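(* Let $\omega$ be a weight on $\mathbb{Z}$. Then $\operatorname{rad}\big(\ell^{1}(\mathbb{Z},\omega)''\big)\neq\{0\}$, where the bidual $\ell^1(\mathbb{Z},\omega)''$ is a Banach algebra under the first Arens product $\Box$.
   Context: A weight on $\mathbb{Z}$ is a function $\omega:\mathbb{Z}\to[1,\infty)$ with $\omega(0)=1$ and $\omega(m+n)\le\omega(m)\omega(n)$ for all $m,n\in\mathbb{Z}$. $\ell^1(\mathbb{Z},\omega)=\{f:\mathbb{Z}\to\mathbb{C}:\|f\|_\omega:=\sum_{n}|f(n)|\omega(n)<\infty\}$, a unital Banach algebra under convolution. For a Banach algebra $A$ with dual $A'$ and bidual $A''$, the first Arens product $\Box$ on $A''$ is defined by $\langle\Psi\Box\Phi,\lambda\rangle=\langle\Psi,\Phi\cdot\lambda\rangle$, $\langle\Phi\cdot\lambda,a\rangle=\langle\Phi,\lambda\cdot a\rangle$, $\langle\lambda\cdot a,b\rangle=\langle\lambda,ab\rangle$ for $\Phi,\Psi\in A''$, $\lambda\in A'$, $a,b\in A$; it makes $A''$ a Banach algebra extending $A$. For a unital Banach algebra $B$, $\operatorname{rad}(B)$ denotes the Jacobson radical: $\operatorname{rad}(B)=\{a\in B: ba\text{ is quasi-nilpotent for every }b\in B\}$, where $a$ is quasi-nilpotent if $\lim_n\|a^n\|^{1/n}=0$. *)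

theory Defs
  imports "HOL-Analysis.Analysis" "HOL-Algebra.Group"
begin

definition weight :: "(int \<Rightarrow> real) \<Rightarrow> bool" where
  "weight \<omega> \<longleftrightarrow> (\<forall>n. 1 \<le> \<omega> n) \<and> \<omega> 0 = 1 \<and> (\<forall>m n. \<omega> (m + n) \<le> \<omega> m * \<omega> n)"

text \<open>
  A normed algebra is given by a carrier set of complex-valued functions on some index type,
  with the pointwise complex-linear structure, together with a product, a unit and a norm.
  Since a dual space again consists of complex-valued functions (on the carrier), the
  construction can be iterated. The carrier is explicit because the weight is a variable,
  so the algebra cannot be a type.
\<close>

record 'x fun_alg = "('x \<Rightarrow> complex) monoid" +
  nrm :: "('x \<Rightarrow> complex) \<Rightarrow> real"

definition l1_alg :: "(int \<Rightarrow> real) \<Rightarrow> int fun_alg" where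
  "l1_alg \<omega> =
    \<lparr>carrier = {f. (\<lambda>n. cmod (f n) * \<omega> n) summable_on UNIV},
     monoid.mult = (\<lambda>f g n. \<Sum>\<^sub>\<infinity>k\<in>UNIV. f k * g (n - k)),
     one = (\<lambda>n. if n = 0 then 1 else 0),
     nrm = (\<lambda>f. \<Sum>\<^sub>\<infinity>n\<in>UNIV. cmod (f n) * \<omega> n)\<rparr>"

text \<open>
  The dual of the normed space \<open>V\<close> (a linear space of functions) with norm \<open>N\<close>.
  Functionals are total functions, normalised to vanish off \<open>V\<close>, so that equality of
  functionals on \<open>V\<close> is equality in HOL and the dual is again closed under the pointwise
  linear operations (which \<^const>\<open>extensional\<close> functions would not be).
\<close>

definition dual_space ::
    "('x \<Rightarrow> complex) set \<Rightarrow> (('x \<Rightarrow> complex) \<Rightarrow> real) \<Rightarrow> (('x \<Rightarrow> complex) \<Rightarrow> complex) set" where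
  "dual_space V N = {\<phi>.
     (\<forall>f\<in>V. \<forall>g\<in>V. \<phi> (\<lambda>x. f x + g x) = \<phi> f + \<phi> g) \<and>
     (\<forall>c. \<forall>f\<in>V. \<phi> (\<lambda>x. c * f x) = c * \<phi> f) \<and>
     (\<exists>C. \<forall>f\<in>V. cmod (\<phi> f) \<le> C * N f) \<and>
     (\<forall>f. f \<notin> V \<longrightarrow> \<phi> f = 0)}"

definition dual_norm ::
    "('x \<Rightarrow> complex) set \<Rightarrow> (('x \<Rightarrow> complex) \<Rightarrow> real) \<Rightarrow> (('x \<Rightarrow> complex) \<Rightarrow> complex) \<Rightarrow> real" where
  "dual_norm V N \<phi> = (SUP f\<in>{f \<in> V. N f \<le> 1}. cmod (\<phi> f))"

abbreviation dual :: "('x, 'm) fun_alg_scheme \<Rightarrow> (('x \<Rightarrow> complex) \<Rightarrow> complex) set" where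
  "dual A \<equiv> dual_space (carrier A) (nrm A)"

text \<open>\<open>\<lambda> \<cdot> a\<close>, for \<open>\<lambda>\<close> in the dual and \<open>a\<close> in the algebra\<close>

definition dual_act ::
    "('x, 'm) fun_alg_scheme \<Rightarrow> (('x \<Rightarrow> complex) \<Rightarrow> complex) \<Rightarrow> ('x \<Rightarrow> complex)
      \<Rightarrow> ('x \<Rightarrow> complex) \<Rightarrow> complex" where
  "dual_act A l a = (\<lambda>b. if b \<in> carrier A then l (a \<otimes>\<^bsub>A\<^esub> b) else 0)"

text \<open>\<open>\<Phi> \<cdot> \<lambda>\<close>, for \<open>\<Phi>\<close> in the bidual and \<open>\<lambda>\<close> in the dual\<close>

definition bidual_act ::
    "('x, 'm) fun_alg_scheme \<Rightarrow> ((('x \<Rightarrow> complex) \<Rightarrow> complex) \<Rightarrow> complex)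
      \<Rightarrow> (('x \<Rightarrow> complex) \<Rightarrow> complex) \<Rightarrow> ('x \<Rightarrow> complex) \<Rightarrow> complex" where
  "bidual_act A \<Phi> l = (\<lambda>a. if a \<in> carrier A then \<Phi> (dual_act A l a) else 0)"

definition arens1 ::
    "('x, 'm) fun_alg_scheme \<Rightarrow> ((('x \<Rightarrow> complex) \<Rightarrow> complex) \<Rightarrow> complex)
      \<Rightarrow> ((('x \<Rightarrow> complex) \<Rightarrow> complex) \<Rightarrow> complex)
      \<Rightarrow> (('x \<Rightarrow> complex) \<Rightarrow> complex) \<Rightarrow> complex" where
  "arens1 A \<Psi> \<Phi> = (\<lambda>l. if l \<in> dual A then \<Psi> (bidual_act A \<Phi> l) else 0)"

definition canonical_embedding ::
    "('x, 'm) fun_alg_scheme \<Rightarrow> ('x \<Rightarrow> complex) \<Rightarrow> (('x \<Rightarrow> complex) \<Rightarrow> complex) \<Rightarrow> complex" where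
  "canonical_embedding A a = (\<lambda>l. if l \<in> dual A then l a else 0)"

definition bidual_alg :: "('x, 'm) fun_alg_scheme \<Rightarrow> (('x \<Rightarrow> complex) \<Rightarrow> complex) fun_alg" where
  "bidual_alg A =
    \<lparr>carrier = dual_space (dual A) (dual_norm (carrier A) (nrm A)),
     monoid.mult = arens1 A,
     one = canonical_embedding A \<one>\<^bsub>A\<^esub>,
     nrm = dual_norm (dual A) (dual_norm (carrier A) (nrm A))\<rparr>"

definition quasi_nilpotent :: "('x, 'm) fun_alg_scheme \<Rightarrow> ('x \<Rightarrow> complex) \<Rightarrow> bool" where
  "quasi_nilpotent B a \<longleftrightarrow> (\<lambda>n::nat. root n (nrm B (a [^]\<^bsub>B\<^esub> n))) \<longlonglongrightarrow> 0"

definition jacobson_radical :: "('x, 'm) fun_alg_scheme \<Rightarrow> ('x \<Rightarrow> complex) set" where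
  "jacobson_radical B = {a \<in> carrier B. \<forall>b\<in>carrier B. quasi_nilpotent B (b \<otimes>\<^bsub>B\<^esub> a)}"

end

theory Submission
  imports Defs
begin

text \<open>
  Let \<open>A\<close> be the algebra \<open>\<ell>\<^sup>1(\<int>, \<omega>)\<close>, let \<open>\<rho>\<close> be the exponential growth rate of \<open>\<omega>\<close> at \<open>+\<infinity>\<close>, that is,
  the largest number with \<open>\<rho>^n \<le> \<omega> n\<close> for all \<open>n \<ge> 0\<close>, and let \<open>\<chi> a = (\<Sum>n. a n * \<rho>^n)\<close>. As
  \<open>\<rho> \<ge> 1\<close> and \<open>\<omega> \<ge> 1\<close>, also \<open>\<rho>^n \<le> \<omega> n\<close> for \<open>n < 0\<close>, so \<open>\<chi>\<close> is a bounded character of \<open>A\<close>.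

  The radical element is a nonzero \<open>\<Phi>\<close> in the bidual with \<open>\<delta>\<^sub>1 \<box> \<Phi> = \<rho> \<Phi>\<close> and \<open>\<Phi> \<chi> = 0\<close>. The first
  property gives \<open>\<Phi> \<cdot> \<lambda> = (\<Phi> \<lambda>) \<chi>\<close> for all \<open>\<lambda>\<close> in the dual, because both sides agree at all
  \<open>\<delta>\<^sub>n\<close>. Hence \<open>\<Psi> \<box> \<Phi> = (\<Psi> \<chi>) \<Phi>\<close> for all \<open>\<Psi>\<close>, and the second property makes every such product
  square to zero (\<open>eigenfunctional_in_radical\<close>).

  Such a \<open>\<Phi>\<close> is a weak-* cluster point of a bounded sequence \<open>f\<^sub>k\<close> in \<open>A\<close> with
  \<open>\<parallel>\<delta>\<^sub>1 * f\<^sub>k - \<rho> f\<^sub>k\<parallel> \<longrightarrow> 0\<close> and \<open>\<chi> f\<^sub>k \<longrightarrow> 0\<close>; it is nonzero if \<open>l f\<^sub>k\<close> has a nonzero limit for some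
  \<open>l\<close> in the dual (\<open>radical_nonzero_if_approximate_eigenvectors\<close>). The building blocks are the
  vectors \<open>b\<^sub>M = (\<Sum>i<M. \<rho>^(-i) \<delta>\<^sub>i)\<close>. With \<open>\<eta> i = \<omega> i / \<rho>^i\<close> and \<open>S M = (\<Sum>i<M. \<eta> i)\<close>,
  one has \<open>\<parallel>b\<^sub>M\<parallel> = S M\<close>, \<open>\<chi> b\<^sub>M = M\<close> and \<open>\<parallel>\<delta>\<^sub>1 * b\<^sub>M - \<rho> b\<^sub>M\<parallel> = \<rho> (1 + \<eta> M)\<close>. Since \<open>\<eta>\<close> grows
  subexponentially, \<open>\<eta> M / S M\<close> is arbitrarily small for arbitrarily large \<open>M\<close>
  (\<open>reduced_weight_slow\<close>). There are two cases.

  If \<open>\<eta> M / S M\<close> and \<open>M / S M\<close> can be made small simultaneously, then \<open>f\<^sub>k = b\<^sub>M / S M\<close> works for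
  suitable \<open>M\<close>, because the functional given by \<open>\<omega>\<close> itself takes the value 1 at each of these vectors.

  Otherwise \<open>S M / M\<close> stays bounded along the \<open>M\<close> with \<open>\<eta> M / S M\<close> small. Then the averages \<open>b\<^sub>M / M\<close>
  are bounded, and \<open>\<chi>\<close> equals 1 at each of them. Along a lacunary sequence of such \<open>M\<close>, a
  functional with signs that alternate from one block of indices to the next takes values
  approaching \<open>1\<close> and \<open>-1\<close> in turn, so the differences of consecutive averages have the
  required properties.
\<close>

section \<open>Duals of normed spaces of functions\<close>

locale function_norm =
  fixes V :: "('x \<Rightarrow> complex) set" and N :: "('x \<Rightarrow> complex) \<Rightarrow> real"
  assumes zero_mem: "(\<lambda>_. 0) \<in> V"
    and scale_mem: "f \<in> V \<Longrightarrow> (\<lambda>x. c * f x) \<in> V"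
    and norm_scale: "f \<in> V \<Longrightarrow> N (\<lambda>x. c * f x) = cmod c * N f"
    and norm_nonneg: "f \<in> V \<Longrightarrow> 0 \<le> N f"
begin

lemma norm_zero: "N (\<lambda>_. 0) = 0"
  using norm_scale[OF zero_mem, of 0] by simp

lemma dual_bdd_above:
  assumes "\<phi> \<in> dual_space V N"
  shows "bdd_above ((\<lambda>f. cmod (\<phi> f)) ` {f \<in> V. N f \<le> 1})"
proof -
  obtain C where C: "\<And>f. f \<in> V \<Longrightarrow> cmod (\<phi> f) \<le> C * N f"
    using assms unfolding dual_space_def by blast
  show ?thesis
  proof (rule bdd_aboveI2)
    fix g assume "g \<in> {f \<in> V. N f \<le> 1}"
    then have g: "g \<in> V" "N g \<le> 1" by auto
    have "cmod (\<phi> g) \<le> C * N g" using C g by auto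
    also have "\<dots> \<le> \<bar>C\<bar> * 1" using g norm_nonneg by (intro mult_mono) auto
    finally show "cmod (\<phi> g) \<le> \<bar>C\<bar> * 1" .
  qed
qed

lemma dual_norm_upper:
  assumes "\<phi> \<in> dual_space V N" "f \<in> V"
  shows "cmod (\<phi> f) \<le> dual_norm V N \<phi> * N f"
proof -
  obtain C where C: "\<And>f. f \<in> V \<Longrightarrow> cmod (\<phi> f) \<le> C * N f"
    using assms(1) unfolding dual_space_def by blast
  note bdd = dual_bdd_above[OF assms(1)]
  show ?thesis
  proof (cases "N f = 0")
    case True
    then show ?thesis using C[OF assms(2)] by simp
  next
    case False
    then have pos: "N f > 0" using norm_nonneg[OF assms(2)] by simp
    define g where "g = (\<lambda>x. complex_of_real (inverse (N f)) * f x)"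
    have g: "g \<in> V" "N g = 1"
      using pos norm_scale[OF assms(2)] scale_mem[OF assms(2)] unfolding g_def
      by (auto simp: norm_inverse simp del: of_real_inverse)
    have "cmod (\<phi> g) \<le> dual_norm V N \<phi>"
      unfolding dual_norm_def using bdd g by (intro cSUP_upper) auto
    moreover have "\<phi> g = complex_of_real (inverse (N f)) * \<phi> f"
      using assms unfolding g_def dual_space_def by blast
    ultimately show ?thesis
      using pos by (simp add: norm_mult norm_inverse norm_divide divide_simps mult.commute)
  qed
qed

lemma dual_norm_least:
  assumes "\<And>f. f \<in> V \<Longrightarrow> cmod (\<phi> f) \<le> C * N f" "0 \<le> C"
  shows "dual_norm V N \<phi> \<le> C"
  unfolding dual_norm_def
proof (rule cSUP_least)
  show "{f \<in> V. N f \<le> 1} \<noteq> {}" using zero_mem norm_zero by auto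
  fix f assume "f \<in> {f \<in> V. N f \<le> 1}"
  then have "f \<in> V" "N f \<le> 1" by auto
  then show "cmod (\<phi> f) \<le> C"
    using assms(1)[of f] mult_left_mono[OF \<open>N f \<le> 1\<close> assms(2)] by simp
qed

lemma dual_norm_zero: "dual_norm V N (\<lambda>_. 0) = 0"
proof -
  have "{f \<in> V. N f \<le> 1} \<noteq> {}" using zero_mem norm_zero by auto
  then show ?thesis unfolding dual_norm_def by simp
qed

lemma dual_norm_nonneg:
  assumes "\<phi> \<in> dual_space V N"
  shows "0 \<le> dual_norm V N \<phi>"
proof -
  have z: "(\<lambda>_. 0) \<in> {f \<in> V. N f \<le> 1}" using zero_mem norm_zero by auto
  have "cmod (\<phi> (\<lambda>_. 0)) \<le> dual_norm V N \<phi>"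
    unfolding dual_norm_def using z dual_bdd_above[OF assms] by (intro cSUP_upper) auto
  then show ?thesis using norm_ge_zero order_trans by blast
qed

lemma zero_mem_dual: "(\<lambda>_. 0) \<in> dual_space V N"
  unfolding dual_space_def by (auto intro!: exI[of _ 0])

lemma dual_scale_mem:
  assumes "\<phi> \<in> dual_space V N"
  shows "(\<lambda>f. c * \<phi> f) \<in> dual_space V N"
proof -
  obtain C where C: "\<And>f. f \<in> V \<Longrightarrow> cmod (\<phi> f) \<le> C * N f"
    using assms unfolding dual_space_def by blast
  have "\<exists>C. \<forall>f\<in>V. cmod (c * \<phi> f) \<le> C * N f"
  proof (intro exI ballI)
    fix f assume "f \<in> V"
    then show "cmod (c * \<phi> f) \<le> (cmod c * C) * N f"
      using C[of f] by (simp add: norm_mult mult.assoc mult_left_mono)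
  qed
  then show ?thesis using assms unfolding dual_space_def
    by (auto simp: algebra_simps)
qed

lemma dual_add_mem:
  assumes "\<phi> \<in> dual_space V N" "\<psi> \<in> dual_space V N"
  shows "(\<lambda>f. \<phi> f + \<psi> f) \<in> dual_space V N"
proof -
  obtain C where C: "\<And>f. f \<in> V \<Longrightarrow> cmod (\<phi> f) \<le> C * N f"
    using assms unfolding dual_space_def by blast
  obtain D where D: "\<And>f. f \<in> V \<Longrightarrow> cmod (\<psi> f) \<le> D * N f"
    using assms unfolding dual_space_def by blast
  have "\<exists>C. \<forall>f\<in>V. cmod (\<phi> f + \<psi> f) \<le> C * N f"
  proof (intro exI ballI)
    fix f assume "f \<in> V"
    then show "cmod (\<phi> f + \<psi> f) \<le> (C + D) * N f"
      using C[of f] D[of f] norm_triangle_ineq[of "\<phi> f" "\<psi> f"] by (simp add: algebra_simps)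
  qed
  then show ?thesis using assms unfolding dual_space_def
    by (auto simp: algebra_simps)
qed

text \<open>
  Banach-Alaoglu for sequences. The evaluations at \<open>f k\<close> lie in a product of closed discs, which
  is compact by Tychonoff, so they have a cluster point. Linearity and the norm bound are closed
  conditions on finitely many coordinates and pass to it, and so does the limit of every coordinate
  that converges.
\<close>

lemma bounded_sequence_cluster_functional:
  assumes f: "\<And>k::nat. f k \<in> V" "\<And>k. N (f k) \<le> C"
  obtains \<Phi> where "\<Phi> \<in> dual_space (dual_space V N) (dual_norm V N)"
    and "\<And>l c. l \<in> dual_space V N \<Longrightarrow> (\<lambda>k. l (f k)) \<longlonglongrightarrow> c \<Longrightarrow> \<Phi> l = c"
proof -
  let ?D = "dual_space V N"
  define g where "g k l = (if l \<in> ?D then l (f k) else 0)" for k l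
  \<comment> \<open>Off the dual the disc has radius 0, which makes the cluster point vanish there.\<close>
  define R where "R l = (if l \<in> ?D then dual_norm V N l * C else 0)" for l
  have C0: "0 \<le> C" using f[of 0] norm_nonneg[of "f 0"] by simp
  have g_le: "cmod (g k l) \<le> R l" for k l
    using dual_norm_upper[of l "f k"] f[of k] mult_left_mono[OF f(2)[of k] dual_norm_nonneg[of l]]
    by (auto simp: g_def R_def)
  have "compactin (product_topology (\<lambda>_. euclidean) UNIV) (PiE UNIV (\<lambda>l. cball 0 (R l) :: complex set))"
    by (simp add: compactin_PiE)
  then have "compact (PiE UNIV (\<lambda>l. cball 0 (R l) :: complex set))"
    by (simp add: euclidean_product_topology)
  moreover have "\<forall>\<^sub>F \<Psi> in filtermap g sequentially. \<Psi> \<in> PiE UNIV (\<lambda>l. cball 0 (R l))"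
    using g_le by (auto simp: eventually_filtermap PiE_def)
  ultimately obtain \<Phi> where \<Phi>: "inf (nhds \<Phi>) (filtermap g sequentially) \<noteq> bot"
    unfolding compact_filter by (metis filtermap_bot_iff trivial_limit_sequentially)
  \<comment> \<open>\<open>G\<close> plays the role of a subnet of the evaluations that converges pointwise to \<open>\<Phi>\<close>.\<close>
  define G where "G = inf (nhds \<Phi>) (filtermap g sequentially)"
  have G: "G \<noteq> bot" "G \<le> nhds \<Phi>" "G \<le> filtermap g sequentially" using \<Phi> unfolding G_def by auto
  have coord: "((\<lambda>\<Psi>. \<Psi> l) \<longlongrightarrow> \<Phi> l) G" for l
  proof -
    have "((\<lambda>\<Psi>. \<Psi> l) \<longlongrightarrow> \<Phi> l) (at \<Phi>)"
      using continuous_on_product_coordinates[of l] unfolding continuous_on_def by blast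
    then have "((\<lambda>\<Psi>. \<Psi> l) \<longlongrightarrow> \<Phi> l) (nhds \<Phi>)"
      using tendsto_at_iff_tendsto_nhds[of "\<lambda>\<Psi>. \<Psi> l" \<Phi>] by simp
    then show ?thesis using G(2) tendsto_mono by blast
  qed
  have lim: "\<Phi> l = c" if "(\<lambda>k. g k l) \<longlonglongrightarrow> c" for l c
  proof -
    have "((\<lambda>\<Psi>. \<Psi> l) \<longlongrightarrow> c) (filtermap g sequentially)"
      using that by (simp add: filterlim_filtermap)
    then have "((\<lambda>\<Psi>. \<Psi> l) \<longlongrightarrow> c) G" using G(3) tendsto_mono by blast
    then show ?thesis using coord[of l] G(1) tendsto_unique by blast
  qed
  have ev: "eventually P G" if "\<And>k. P (g k)" for P
    using that G(3) by (auto simp: le_filter_def eventually_filtermap)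
  have add: "\<Phi> (\<lambda>x. l x + m x) = \<Phi> l + \<Phi> m" if "l \<in> ?D" "m \<in> ?D" for l m
  proof -
    have *: "g k (\<lambda>x. l x + m x) = g k l + g k m" for k
      using that dual_add_mem[OF that] by (simp add: g_def)
    have "((\<lambda>\<Psi>. \<Psi> (\<lambda>x. l x + m x) - (\<Psi> l + \<Psi> m)) \<longlongrightarrow> \<Phi> (\<lambda>x. l x + m x) - (\<Phi> l + \<Phi> m)) G"
      by (intro tendsto_intros coord)
    moreover have "((\<lambda>\<Psi>. \<Psi> (\<lambda>x. l x + m x) - (\<Psi> l + \<Psi> m)) \<longlongrightarrow> 0) G"
      by (rule tendsto_eventually, rule ev) (simp add: *)
    ultimately show ?thesis using G(1) tendsto_unique by fastforce
  qed
  have scale: "\<Phi> (\<lambda>x. c * l x) = c * \<Phi> l" if "l \<in> ?D" for c l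
  proof -
    have *: "g k (\<lambda>x. c * l x) = c * g k l" for k
      using that dual_scale_mem[OF that] by (simp add: g_def)
    have "((\<lambda>\<Psi>. \<Psi> (\<lambda>x. c * l x) - c * \<Psi> l) \<longlongrightarrow> \<Phi> (\<lambda>x. c * l x) - c * \<Phi> l) G"
      by (intro tendsto_intros coord)
    moreover have "((\<lambda>\<Psi>. \<Psi> (\<lambda>x. c * l x) - c * \<Psi> l) \<longlongrightarrow> 0) G"
      by (rule tendsto_eventually, rule ev) (simp add: *)
    ultimately show ?thesis using G(1) tendsto_unique by fastforce
  qed
  have bd: "cmod (\<Phi> l) \<le> R l" for l
    by (rule tendsto_upperbound[OF tendsto_norm[OF coord[of l]] _ G(1)], rule ev, rule g_le)
  have "\<Phi> \<in> dual_space ?D (dual_norm V N)"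
    unfolding dual_space_def[of ?D]
  proof (intro CollectI conjI ballI allI impI exI)
    fix l assume "l \<in> ?D"
    then show "cmod (\<Phi> l) \<le> C * dual_norm V N l" using bd[of l] by (simp add: R_def mult.commute)
  next
    fix l assume "l \<notin> ?D"
    then show "\<Phi> l = 0" using bd[of l] by (simp add: R_def)
  qed (use add scale in auto)
  moreover have "\<Phi> l = c" if "l \<in> ?D" "(\<lambda>k. l (f k)) \<longlonglongrightarrow> c" for l c
    using lim[of l c] that by (simp add: g_def)
  ultimately show ?thesis using that by blast
qed

end

section \<open>The Beurling algebra and its dual\<close>

locale beurling_algebra =
  fixes \<omega> :: "int \<Rightarrow> real"
  assumes weight: "weight \<omega>"
begin

abbreviation "A \<equiv> l1_alg \<omega>"
abbreviation "V \<equiv> carrier A"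
abbreviation "N \<equiv> nrm A"

lemma weight_ge_1: "1 \<le> \<omega> n" and weight_0: "\<omega> 0 = 1" and weight_mult: "\<omega> (m + n) \<le> \<omega> m * \<omega> n"
  using weight by (auto simp: weight_def)

lemma weight_nonneg [simp]: "0 \<le> \<omega> n"
  using weight_ge_1[of n] by linarith

lemma mem_iff: "f \<in> V \<longleftrightarrow> (\<lambda>n. cmod (f n) * \<omega> n) summable_on UNIV"
  by (simp add: l1_alg_def)

lemma N_def: "N f = (\<Sum>\<^sub>\<infinity>n\<in>UNIV. cmod (f n) * \<omega> n)"
  by (simp add: l1_alg_def)

lemma has_sum_N: "f \<in> V \<Longrightarrow> ((\<lambda>n. cmod (f n) * \<omega> n) has_sum N f) UNIV"
  by (simp add: mem_iff N_def)

lemma mult_conv: "f \<otimes>\<^bsub>A\<^esub> g = (\<lambda>n. \<Sum>\<^sub>\<infinity>k\<in>UNIV. f k * g (n - k))"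
  by (simp add: l1_alg_def)

lemma scale_has_sum:
  assumes "f \<in> V"
  shows "((\<lambda>n. cmod (c * f n) * \<omega> n) has_sum (cmod c * N f)) UNIV"
  using has_sum_cmult_right[OF has_sum_N[OF assms], of "cmod c"] by (simp add: norm_mult mult.assoc)

sublocale function_norm V N
proof
  show "(\<lambda>_. 0) \<in> V" by (simp add: mem_iff)
  show "(\<lambda>x. c * f x) \<in> V" "N (\<lambda>x. c * f x) = cmod c * N f" if "f \<in> V" for f c
    using scale_has_sum[OF that, of c] by (auto simp: mem_iff N_def[of "\<lambda>x. c * f x"] has_sum_iff)
  show "0 \<le> N f" if "f \<in> V" for f
    unfolding N_def by (intro infsum_nonneg) simp
qed

text \<open>
  Both membership and the norm of a function are controlled by a summable majorant; this is how
  sums and convolutions are estimated.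
\<close>

lemma domination:
  assumes "\<And>n. cmod (f n) * \<omega> n \<le> g n" "(g has_sum G) UNIV"
  shows "f \<in> V" "N f \<le> G"
proof -
  show f: "f \<in> V" unfolding mem_iff
    by (rule summable_on_comparison_test[OF has_sum_imp_summable[OF assms(2)]]) (use assms(1) in auto)
  show "N f \<le> G" by (rule has_sum_mono[OF has_sum_N[OF f] assms(2)]) (use assms(1) in auto)
qed

lemma add_mem: "(\<lambda>n. f n + g n) \<in> V"
  and N_add: "N (\<lambda>n. f n + g n) \<le> N f + N g" if "f \<in> V" "g \<in> V"
proof -
  have *: "cmod (f n + g n) * \<omega> n \<le> cmod (f n) * \<omega> n + cmod (g n) * \<omega> n" for n
    using mult_right_mono[OF norm_triangle_ineq[of "f n" "g n"] weight_nonneg[of n]]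
    by (simp add: algebra_simps)
  note d = domination[OF * has_sum_add[OF has_sum_N[OF that(1)] has_sum_N[OF that(2)]]]
  show "(\<lambda>n. f n + g n) \<in> V" "N (\<lambda>n. f n + g n) \<le> N f + N g" using d by auto
qed

definition \<delta> :: "int \<Rightarrow> int \<Rightarrow> complex" where
  "\<delta> m = (\<lambda>n. if n = m then 1 else 0)"

lemma finite_support_has_sum:
  assumes "finite F" "\<And>n. n \<notin> F \<Longrightarrow> f n = 0"
  shows "((\<lambda>n. cmod (f n) * \<omega> n) has_sum (\<Sum>n\<in>F. cmod (f n) * \<omega> n)) UNIV"
  using assms by (intro has_sum_finite_neutralI) auto

lemma finite_support_mem:
  assumes "finite F" "\<And>n. n \<notin> F \<Longrightarrow> f n = 0"
  shows "f \<in> V" "N f = (\<Sum>n\<in>F. cmod (f n) * \<omega> n)"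
  using finite_support_has_sum[OF assms] by (auto simp: mem_iff N_def has_sum_iff)

lemma delta_mem: "\<delta> m \<in> V"
  by (rule finite_support_mem[of "{m}"]) (auto simp: \<delta>_def)

lemma delta_mult: "\<delta> m \<otimes>\<^bsub>A\<^esub> b = (\<lambda>n. b (n - m))"
proof
  fix n
  have "((\<lambda>k. \<delta> m k * b (n - k)) has_sum (\<Sum>k\<in>{m}. \<delta> m k * b (n - k))) UNIV"
    by (rule has_sum_finite_neutralI[of "{m}"]) (auto simp: \<delta>_def)
  then show "(\<delta> m \<otimes>\<^bsub>A\<^esub> b) n = b (n - m)"
    unfolding mult_conv by (simp add: infsumI \<delta>_def)
qed

lemma one_eq_delta: "\<one>\<^bsub>A\<^esub> = \<delta> 0"
  by (simp add: l1_alg_def \<delta>_def)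

text \<open>
  Tonelli for the double family \<open>p k n\<close>, whose sum over \<open>n\<close> and then \<open>k\<close> is \<open>N a * N b\<close>;
  submultiplicativity of the weight says that it dominates the terms of the convolution.
\<close>

lemma
  assumes a: "a \<in> V" and b: "b \<in> V"
  shows convolution_summable: "(\<lambda>k. a k * b (n - k)) summable_on UNIV"
    and mult_mem: "a \<otimes>\<^bsub>A\<^esub> b \<in> V"
    and N_mult: "N (a \<otimes>\<^bsub>A\<^esub> b) \<le> N a * N b"
proof -
  define p where "p k n = (cmod (a k) * \<omega> k) * (cmod (b (n - k)) * \<omega> (n - k))" for k n
  have p_nonneg: "0 \<le> p k n" for k n by (simp add: p_def)
  have shift: "((\<lambda>n. cmod (b (n - k)) * \<omega> (n - k)) has_sum N b) UNIV" for k
    using has_sum_reindex_bij_betw[of "\<lambda>n. n - k" UNIV UNIV "\<lambda>n. cmod (b n) * \<omega> n" "N b"] has_sum_N[OF b]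
    by (simp add: bij_betw_def inj_on_def surj_def)
  have row: "((\<lambda>n. p k n) has_sum ((cmod (a k) * \<omega> k) * N b)) UNIV" for k
    unfolding p_def by (rule has_sum_cmult_right[OF shift])
  have col: "((\<lambda>k. (cmod (a k) * \<omega> k) * N b) has_sum (N a * N b)) UNIV"
    by (rule has_sum_cmult_left[OF has_sum_N[OF a]])
  have "(\<lambda>(k,n). p k n) summable_on (UNIV \<times> UNIV)"
    by (rule summable_on_SigmaI[where g = "\<lambda>k. (cmod (a k) * \<omega> k) * N b"])
      (use row col p_nonneg in \<open>auto simp: has_sum_iff\<close>)
  then have "((\<lambda>(k,n). p k n) has_sum (N a * N b)) (UNIV \<times> UNIV)"
    by (intro has_sum_SigmaI[where g = "\<lambda>k. (cmod (a k) * \<omega> k) * N b"]) (use row col in auto)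
  then have swapped: "((\<lambda>(n,k). p k n) has_sum (N a * N b)) (UNIV \<times> UNIV)"
    by (subst has_sum_swap) (simp add: case_prod_unfold)
  have p_col: "(\<lambda>k. p k n) summable_on UNIV" for n
    using summable_on_SigmaD1[OF has_sum_imp_summable[OF swapped], of n] by simp
  define G where "G n = (\<Sum>\<^sub>\<infinity>k\<in>UNIV. p k n)" for n
  have G: "((\<lambda>n. G n) has_sum (N a * N b)) UNIV"
    by (rule has_sum_SigmaD[OF swapped]) (simp add: G_def p_col)
  have term_le: "cmod (a k * b (n - k)) * \<omega> n \<le> p k n" for k n
  proof -
    have "\<omega> n \<le> \<omega> k * \<omega> (n - k)" using weight_mult[of k "n - k"] by simp
    then have "cmod (a k * b (n - k)) * \<omega> n \<le> cmod (a k * b (n - k)) * (\<omega> k * \<omega> (n - k))"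
      by (intro mult_left_mono) auto
    then show ?thesis by (simp add: p_def norm_mult mult_ac)
  qed
  have abs: "(\<lambda>k. cmod (a k * b (n - k))) summable_on UNIV" for n
  proof (rule summable_on_comparison_test[OF p_col[of n]])
    fix k
    have "cmod (a k * b (n - k)) * 1 \<le> cmod (a k * b (n - k)) * \<omega> n"
      by (intro mult_left_mono) (use weight_ge_1 in auto)
    then show "cmod (a k * b (n - k)) \<le> p k n" using term_le[of k n] by simp
  qed auto
  then show "(\<lambda>k. a k * b (n - k)) summable_on UNIV" for n
    by (rule abs_summable_summable)
  have le: "cmod ((a \<otimes>\<^bsub>A\<^esub> b) n) * \<omega> n \<le> G n" for n
  proof -
    have "cmod ((a \<otimes>\<^bsub>A\<^esub> b) n) * \<omega> n \<le> (\<Sum>\<^sub>\<infinity>k\<in>UNIV. cmod (a k * b (n - k))) * \<omega> n"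
      unfolding mult_conv by (intro mult_right_mono norm_infsum_bound abs) auto
    also have "\<dots> = (\<Sum>\<^sub>\<infinity>k\<in>UNIV. cmod (a k * b (n - k)) * \<omega> n)"
      by (rule infsum_cmult_left'[symmetric])
    also have "\<dots> \<le> G n" unfolding G_def
      by (intro infsum_mono summable_on_cmult_left abs p_col term_le)
    finally show ?thesis .
  qed
  show "a \<otimes>\<^bsub>A\<^esub> b \<in> V" "N (a \<otimes>\<^bsub>A\<^esub> b) \<le> N a * N b"
    using domination[OF le G] by auto
qed

lemma mult_add_right: "a \<in> V \<Longrightarrow> b \<in> V \<Longrightarrow> c \<in> V \<Longrightarrow>
    a \<otimes>\<^bsub>A\<^esub> (\<lambda>n. b n + c n) = (\<lambda>n. (a \<otimes>\<^bsub>A\<^esub> b) n + (a \<otimes>\<^bsub>A\<^esub> c) n)"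
  unfolding mult_conv by (simp add: algebra_simps infsum_add convolution_summable)

lemma mult_add_left: "a \<in> V \<Longrightarrow> b \<in> V \<Longrightarrow> c \<in> V \<Longrightarrow>
    (\<lambda>n. a n + b n) \<otimes>\<^bsub>A\<^esub> c = (\<lambda>n. (a \<otimes>\<^bsub>A\<^esub> c) n + (b \<otimes>\<^bsub>A\<^esub> c) n)"
  unfolding mult_conv by (simp add: algebra_simps infsum_add convolution_summable)

lemma mult_scale_right: "a \<otimes>\<^bsub>A\<^esub> (\<lambda>n. z * b n) = (\<lambda>n. z * (a \<otimes>\<^bsub>A\<^esub> b) n)"
  unfolding mult_conv by (simp add: mult.left_commute infsum_cmult_right')

lemma mult_scale_left: "(\<lambda>n. z * a n) \<otimes>\<^bsub>A\<^esub> b = (\<lambda>n. z * (a \<otimes>\<^bsub>A\<^esub> b) n)"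
  unfolding mult_conv by (simp add: mult.assoc infsum_cmult_right')

lemma dual_memI:
  assumes "\<And>f g. f \<in> V \<Longrightarrow> g \<in> V \<Longrightarrow> \<phi> (\<lambda>x. f x + g x) = \<phi> f + \<phi> g"
    and "\<And>c f. f \<in> V \<Longrightarrow> \<phi> (\<lambda>x. c * f x) = c * \<phi> f"
    and "\<And>f. f \<in> V \<Longrightarrow> cmod (\<phi> f) \<le> C * N f"
    and "\<And>f. f \<notin> V \<Longrightarrow> \<phi> f = 0"
  shows "\<phi> \<in> dual A"
  using assms unfolding dual_space_def by blast

lemma dual_add: "\<phi> \<in> dual A \<Longrightarrow> f \<in> V \<Longrightarrow> g \<in> V \<Longrightarrow> \<phi> (\<lambda>x. f x + g x) = \<phi> f + \<phi> g"
  and dual_scale: "\<phi> \<in> dual A \<Longrightarrow> f \<in> V \<Longrightarrow> \<phi> (\<lambda>x. c * f x) = c * \<phi> f"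
  and dual_outside: "\<phi> \<in> dual A \<Longrightarrow> f \<notin> V \<Longrightarrow> \<phi> f = 0"
  unfolding dual_space_def by blast+

lemma dual_act_bound:
  assumes "l \<in> dual A" "a \<in> V" "b \<in> V"
  shows "cmod (dual_act A l a b) \<le> dual_norm V N l * N a * N b"
proof -
  have "cmod (dual_act A l a b) \<le> dual_norm V N l * N (a \<otimes>\<^bsub>A\<^esub> b)"
    using assms by (simp add: dual_act_def dual_norm_upper mult_mem)
  also have "\<dots> \<le> dual_norm V N l * (N a * N b)"
    using assms by (intro mult_left_mono N_mult dual_norm_nonneg)
  finally show ?thesis by (simp add: mult.assoc)
qed

lemma dual_act_mem:
  assumes l: "l \<in> dual A" and a: "a \<in> V"
  shows "dual_act A l a \<in> dual A"
proof (rule dual_memI[OF _ _ dual_act_bound[OF l a]])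
  fix f g assume "f \<in> V" "g \<in> V"
  then show "dual_act A l a (\<lambda>x. f x + g x) = dual_act A l a f + dual_act A l a g"
    using l a by (simp add: dual_act_def add_mem mult_add_right dual_add mult_mem)
next
  fix c f assume "f \<in> V"
  then show "dual_act A l a (\<lambda>x. c * f x) = c * dual_act A l a f"
    using l a by (simp add: dual_act_def scale_mem mult_scale_right dual_scale mult_mem)
qed (simp_all add: dual_act_def)

lemma dual_act_norm:
  assumes "l \<in> dual A" "a \<in> V"
  shows "dual_norm V N (dual_act A l a) \<le> dual_norm V N l * N a"
  using assms by (intro dual_norm_least dual_act_bound mult_nonneg_nonneg dual_norm_nonneg norm_nonneg)

lemma bidual_carrier: "carrier (bidual_alg A) = dual_space (dual A) (dual_norm V N)"
  by (simp add: bidual_alg_def)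

lemma bidual_add: "\<Phi> \<in> carrier (bidual_alg A) \<Longrightarrow> l \<in> dual A \<Longrightarrow> m \<in> dual A \<Longrightarrow> \<Phi> (\<lambda>x. l x + m x) = \<Phi> l + \<Phi> m"
  and bidual_scale: "\<Phi> \<in> carrier (bidual_alg A) \<Longrightarrow> l \<in> dual A \<Longrightarrow> \<Phi> (\<lambda>x. c * l x) = c * \<Phi> l"
  and bidual_outside: "\<Phi> \<in> carrier (bidual_alg A) \<Longrightarrow> l \<notin> dual A \<Longrightarrow> \<Phi> l = 0"
  unfolding bidual_carrier dual_space_def[of "dual A"] by blast+

lemma bidual_act_mem:
  assumes \<Phi>: "\<Phi> \<in> carrier (bidual_alg A)" and l: "l \<in> dual A"
  shows "bidual_act A \<Phi> l \<in> dual A"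
proof -
  obtain C where C: "\<And>l. l \<in> dual A \<Longrightarrow> cmod (\<Phi> l) \<le> C * dual_norm V N l"
    using \<Phi> unfolding bidual_carrier dual_space_def[of "dual A"] by blast
  show ?thesis
  proof (rule dual_memI)
    fix a b assume ab: "a \<in> V" "b \<in> V"
    have "dual_act A l (\<lambda>x. a x + b x) = (\<lambda>x. dual_act A l a x + dual_act A l b x)"
      using l ab by (auto simp: dual_act_def add_mem mult_add_left dual_add mult_mem fun_eq_iff)
    then show "bidual_act A \<Phi> l (\<lambda>x. a x + b x) = bidual_act A \<Phi> l a + bidual_act A \<Phi> l b"
      using \<Phi> l ab by (simp add: bidual_act_def add_mem bidual_add dual_act_mem)
  next
    fix c a assume a: "a \<in> V"
    have "dual_act A l (\<lambda>x. c * a x) = (\<lambda>x. c * dual_act A l a x)"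
      using l a by (auto simp: dual_act_def scale_mem mult_scale_left dual_scale mult_mem fun_eq_iff)
    then show "bidual_act A \<Phi> l (\<lambda>x. c * a x) = c * bidual_act A \<Phi> l a"
      using \<Phi> l a by (simp add: bidual_act_def scale_mem bidual_scale dual_act_mem)
  next
    fix a assume a: "a \<in> V"
    have "cmod (bidual_act A \<Phi> l a) \<le> C * dual_norm V N (dual_act A l a)"
      using a l C dual_act_mem by (simp add: bidual_act_def)
    also have "\<dots> \<le> \<bar>C\<bar> * (dual_norm V N l * N a)"
      using a l dual_act_norm dual_act_mem by (intro mult_mono) (auto simp: dual_norm_nonneg)
    finally show "cmod (bidual_act A \<Phi> l a) \<le> (\<bar>C\<bar> * dual_norm V N l) * N a" by (simp add: mult.assoc)
  qed (simp add: bidual_act_def)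
qed

lemma dual_finite_support:
  assumes l: "l \<in> dual A" and F: "finite F"
  shows "l (\<lambda>n. if n \<in> F then a n else 0) = (\<Sum>n\<in>F. a n * l (\<delta> n))"
  using F
proof (induction F)
  case empty
  show ?case using dual_scale[OF l zero_mem, of 0] by simp
next
  case (insert m F)
  let ?f = "\<lambda>n. if n \<in> F then a n else 0"
  have f: "?f \<in> V" using insert(1) by (intro finite_support_mem[of F]) auto
  have eq: "(\<lambda>n. if n \<in> insert m F then a n else 0) = (\<lambda>n. (\<lambda>n. a m * \<delta> m n) n + ?f n)"
    using insert(2) by (auto simp: \<delta>_def)
  show ?case
    unfolding eq using insert
    by (subst dual_add[OF l scale_mem[OF delta_mem] f]) (simp add: dual_scale[OF l delta_mem])
qed

text \<open>
  The span of the \<open>\<delta> n\<close> is dense: cutting \<open>a\<close> off outside a finite set \<open>F\<close> changes it by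
  \<open>N a - (\<Sum>n\<in>F. cmod (a n) * \<omega> n)\<close> in norm, which tends to 0.
\<close>

lemma dual_eqI:
  assumes l: "l \<in> dual A" and m: "m \<in> dual A" and eq: "\<And>n. l (\<delta> n) = m (\<delta> n)"
  shows "l = m"
proof
  fix a
  show "l a = m a"
  proof (cases "a \<in> V")
    case False
    then show ?thesis using dual_outside[OF l False] dual_outside[OF m False] by simp
  next
    case a: True
    define C where "C = dual_norm V N l + dual_norm V N m"
    have bound: "cmod (l a - m a) \<le> C * (N a - (\<Sum>n\<in>F. cmod (a n) * \<omega> n))" if F: "finite F" for F
    proof -
      let ?f = "\<lambda>n. if n \<in> F then a n else 0" and ?g = "\<lambda>n. if n \<in> F then 0 else a n"
      have f: "?f \<in> V" using F by (intro finite_support_mem[of F]) auto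
      have "((\<lambda>n. cmod (?f n) * \<omega> n) has_sum (\<Sum>n\<in>F. cmod (?f n) * \<omega> n)) UNIV"
        by (rule finite_support_has_sum[OF F]) auto
      note tail = has_sum_add[OF has_sum_N[OF a] has_sum_uminusI[OF this]]
      have "cmod (?g n) * \<omega> n = cmod (a n) * \<omega> n + - (cmod (?f n) * \<omega> n)" for n by simp
      then have "((\<lambda>n. cmod (?g n) * \<omega> n) has_sum (N a + - (\<Sum>n\<in>F. cmod (?f n) * \<omega> n))) UNIV"
        using tail by presburger
      moreover have "(\<Sum>n\<in>F. cmod (?f n) * \<omega> n) = (\<Sum>n\<in>F. cmod (a n) * \<omega> n)"
        by (rule sum.cong) auto
      ultimately have "((\<lambda>n. cmod (?g n) * \<omega> n) has_sum (N a - (\<Sum>n\<in>F. cmod (a n) * \<omega> n))) UNIV"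
        by simp
      then have g: "?g \<in> V" "N ?g \<le> N a - (\<Sum>n\<in>F. cmod (a n) * \<omega> n)"
        using domination[of ?g "\<lambda>n. cmod (?g n) * \<omega> n"] by auto
      have a_eq: "a = (\<lambda>n. ?f n + ?g n)" by auto
      have "l a - m a = l ?g - m ?g"
        using dual_add[OF l f g(1)] dual_add[OF m f g(1)] dual_finite_support[OF l F, of a]
          dual_finite_support[OF m F, of a] eq unfolding a_eq[symmetric] by simp
      also have "cmod \<dots> \<le> C * N ?g"
        using dual_norm_upper[OF l g(1)] dual_norm_upper[OF m g(1)] norm_triangle_ineq4[of "l ?g" "m ?g"]
        by (simp add: C_def algebra_simps)
      also have "\<dots> \<le> C * (N a - (\<Sum>n\<in>F. cmod (a n) * \<omega> n))"
        using g(2) dual_norm_nonneg[OF l] dual_norm_nonneg[OF m] by (intro mult_left_mono) (auto simp: C_def)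
      finally show ?thesis .
    qed
    have "((\<lambda>F. C * (N a - (\<Sum>n\<in>F. cmod (a n) * \<omega> n))) \<longlongrightarrow> C * (N a - N a)) (finite_subsets_at_top UNIV)"
      using has_sum_N[OF a] unfolding has_sum_def by (intro tendsto_intros)
    then have "cmod (l a - m a) \<le> C * (N a - N a)"
      by (rule tendsto_lowerbound) (auto intro!: eventually_finite_subsets_at_top_weakI bound)
    then show ?thesis by simp
  qed
qed

text \<open>
  The duality between \<open>\<ell>\<^sup>1(\<int>, \<omega>)\<close> and \<open>\<ell>\<^sup>\<infinity>(\<int>, 1/\<omega>)\<close>.
\<close>

definition pairing :: "(int \<Rightarrow> complex) \<Rightarrow> (int \<Rightarrow> complex) \<Rightarrow> complex" where
  "pairing w a = (if a \<in> V then \<Sum>\<^sub>\<infinity>n\<in>UNIV. a n * w n else 0)"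

lemma pairing_mem:
  assumes w: "\<And>n. cmod (w n) \<le> \<omega> n"
  shows "pairing w \<in> dual A"
proof -
  have le: "cmod (a n * w n) \<le> cmod (a n) * \<omega> n" for a n
    using w[of n] by (simp add: norm_mult mult_left_mono)
  have abs: "(\<lambda>n. cmod (a n * w n)) summable_on UNIV" if "a \<in> V" for a
    using that le unfolding mem_iff by (rule summable_on_comparison_test) auto
  then have sm: "(\<lambda>n. a n * w n) summable_on UNIV" if "a \<in> V" for a
    by (rule abs_summable_summable) (use that in auto)
  show ?thesis
  proof (rule dual_memI)
    fix a b assume "a \<in> V" "b \<in> V"
    then show "pairing w (\<lambda>x. a x + b x) = pairing w a + pairing w b"
      by (simp add: pairing_def add_mem algebra_simps infsum_add sm)
  next
    fix c a assume "a \<in> V"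
    then show "pairing w (\<lambda>x. c * a x) = c * pairing w a"
      by (simp add: pairing_def scale_mem mult.assoc infsum_cmult_right')
  next
    fix a assume a: "a \<in> V"
    have "cmod (pairing w a) \<le> N a"
      using norm_infsum_le[OF has_sum_infsum[OF sm[OF a]] has_sum_N[OF a]] le a by (simp add: pairing_def)
    then show "cmod (pairing w a) \<le> 1 * N a" by simp
  qed (simp add: pairing_def)
qed

lemma pairing_finite_support:
  assumes "finite F" "\<And>n. n \<notin> F \<Longrightarrow> a n = 0"
  shows "pairing w a = (\<Sum>n\<in>F. a n * w n)"
proof -
  have "((\<lambda>n. a n * w n) has_sum (\<Sum>n\<in>F. a n * w n)) UNIV"
    using assms by (intro has_sum_finite_neutralI) auto
  then show ?thesis using finite_support_mem(1)[OF assms] by (simp add: pairing_def infsumI)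
qed

lemma pairing_delta: "pairing w (\<delta> m) = w m"
  by (subst pairing_finite_support[of "{m}"]) (auto simp: \<delta>_def)

section \<open>Eigenfunctionals of the shift in the bidual\<close>

definition character :: "complex \<Rightarrow> (int \<Rightarrow> complex) \<Rightarrow> complex" where
  "character z = pairing (\<lambda>n. z powi n)"

lemma bidual_alg_simps:
  "monoid.mult (bidual_alg A) = arens1 A" "one (bidual_alg A) = canonical_embedding A (\<delta> 0)"
  "nrm (bidual_alg A) = dual_norm (dual A) (dual_norm V N)"
  by (simp_all add: bidual_alg_def one_eq_delta)

text \<open>
  This makes the facts about duals available one level up, for the bidual.
\<close>

lemma dual_function_norm: "function_norm (dual A) (dual_norm V N)"
proof
  show "(\<lambda>_. 0) \<in> dual A" by (rule zero_mem_dual)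
  show "(\<lambda>x. c * f x) \<in> dual A" if "f \<in> dual A" for c f by (rule dual_scale_mem[OF that])
  show "0 \<le> dual_norm V N f" if "f \<in> dual A" for f by (rule dual_norm_nonneg[OF that])
  show "dual_norm V N (\<lambda>x. c * f x) = cmod c * dual_norm V N f" if f: "f \<in> dual A" for c f
  proof -
    have le: "dual_norm V N (\<lambda>x. c * f x) \<le> cmod c * dual_norm V N f" if f: "f \<in> dual A" for c f
      using f dual_norm_nonneg[OF f] dual_norm_upper[OF f]
      by (intro dual_norm_least) (auto simp: norm_mult mult.assoc intro!: mult_left_mono)
    show ?thesis
    proof (cases "c = 0")
      case True
      then show ?thesis by (simp add: dual_norm_zero)
    next
      case False
      have "dual_norm V N f = dual_norm V N (\<lambda>x. inverse c * (c * f x))" using False by (simp add: field_simps)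
      also have "\<dots> \<le> cmod (inverse c) * dual_norm V N (\<lambda>x. c * f x)"
        by (rule le[OF dual_scale_mem[OF f]])
      finally have "cmod c * dual_norm V N f \<le> dual_norm V N (\<lambda>x. c * f x)"
        using False by (simp add: norm_inverse norm_divide field_simps)
      then show ?thesis using le[OF f, of c] by simp
    qed
  qed
qed

lemma dual_act_delta_comp:
  "dual_act A (dual_act A l (\<delta> m)) (\<delta> n) = dual_act A l (\<delta> (m + n))"
proof
  fix b
  show "dual_act A (dual_act A l (\<delta> m)) (\<delta> n) b = dual_act A l (\<delta> (m + n)) b"
    using mult_mem[OF delta_mem, of b n]
    by (auto simp: dual_act_def delta_mult algebra_simps)
qed

lemma dual_act_delta_0: "l \<in> dual A \<Longrightarrow> dual_act A l (\<delta> 0) = l"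
  by (auto simp: dual_act_def delta_mult dual_outside fun_eq_iff)

text \<open>
  This is \<open>\<delta>\<^sub>1 \<box> \<Phi> = z \<Phi>\<close>, written out at a functional \<open>l\<close>.
\<close>

definition eigenfunctional :: "complex \<Rightarrow> (((int \<Rightarrow> complex) \<Rightarrow> complex) \<Rightarrow> complex) \<Rightarrow> bool" where
  "eigenfunctional z \<Phi> \<longleftrightarrow> \<Phi> \<in> carrier (bidual_alg A) \<and>
     (\<forall>l\<in>dual A. \<Phi> (dual_act A l (\<delta> 1)) = z * \<Phi> l)"

text \<open>
  Since \<open>\<delta>\<^sub>1\<close> is invertible with powers \<open>\<delta>\<^sub>n\<close>, the eigenvalue equation propagates in both
  directions from \<open>n = 0\<close>.
\<close>

lemma eigenfunctional_delta:
  assumes \<Phi>: "eigenfunctional z \<Phi>" and z: "z \<noteq> 0" and l: "l \<in> dual A"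
  shows "\<Phi> (dual_act A l (\<delta> n)) = z powi n * \<Phi> l"
proof -
  have step: "\<Phi> (dual_act A l (\<delta> (n + 1))) = z * \<Phi> (dual_act A l (\<delta> n))" for n
    using \<Phi> dual_act_mem[OF l delta_mem, of n]
    by (simp add: eigenfunctional_def flip: dual_act_delta_comp)
  show ?thesis
  proof (induction n rule: int_induct[where k = 0])
    case base
    then show ?case using dual_act_delta_0[OF l] by simp
  next
    case (step1 i)
    then show ?case using step[of i] z by (simp add: power_int_add)
  next
    case (step2 i)
    then show ?case using step[of "i - 1"] z by (simp add: power_int_diff field_simps)
  qed
qed

lemma character_mem:
  assumes "\<And>n. cmod z powi n \<le> \<omega> n"
  shows "character z \<in> dual A"
  unfolding character_def using assms by (intro pairing_mem) (simp add: norm_power_int)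

lemma eigenfunctional_act:
  assumes \<Phi>: "eigenfunctional z \<Phi>" and z: "z \<noteq> 0" "\<And>n. cmod z powi n \<le> \<omega> n"
    and l: "l \<in> dual A"
  shows "bidual_act A \<Phi> l = (\<lambda>a. \<Phi> l * character z a)"
proof (rule dual_eqI)
  show "bidual_act A \<Phi> l \<in> dual A"
    using \<Phi> l by (intro bidual_act_mem) (auto simp: eigenfunctional_def)
  show "(\<lambda>a. \<Phi> l * character z a) \<in> dual A"
    by (intro dual_scale_mem character_mem z)
  show "bidual_act A \<Phi> l (\<delta> n) = \<Phi> l * character z (\<delta> n)" for n
    using eigenfunctional_delta[OF \<Phi> z(1) l, of n] delta_mem
    by (simp add: bidual_act_def character_def pairing_delta)
qed

lemma eigenfunctional_arens:
  assumes \<Phi>: "eigenfunctional z \<Phi>" and z: "z \<noteq> 0" "\<And>n. cmod z powi n \<le> \<omega> n"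
    and \<Psi>: "\<Psi> \<in> carrier (bidual_alg A)"
  shows "arens1 A \<Psi> \<Phi> = (\<lambda>l. \<Psi> (character z) * \<Phi> l)"
proof
  fix l
  show "arens1 A \<Psi> \<Phi> l = \<Psi> (character z) * \<Phi> l"
  proof (cases "l \<in> dual A")
    case True
    then show ?thesis
      using eigenfunctional_act[OF \<Phi> z True] bidual_scale[OF \<Psi> character_mem[OF z(2)]]
      by (simp add: arens1_def)
  next
    case False
    then show ?thesis using \<Phi> bidual_outside by (simp add: arens1_def eigenfunctional_def)
  qed
qed

lemma bidual_scale_mem:
  assumes "\<Phi> \<in> carrier (bidual_alg A)"
  shows "(\<lambda>l. c * \<Phi> l) \<in> carrier (bidual_alg A)"
  using assms function_norm.dual_scale_mem[OF dual_function_norm] unfolding bidual_carrier by blast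

lemma embedding_mem:
  assumes "a \<in> V"
  shows "canonical_embedding A a \<in> carrier (bidual_alg A)"
proof -
  have "cmod (canonical_embedding A a l) \<le> N a * dual_norm V N l" if "l \<in> dual A" for l
    using dual_norm_upper[OF that assms] that by (simp add: canonical_embedding_def mult.commute)
  then show ?thesis
    unfolding bidual_carrier dual_space_def[of "dual A"]
    by (auto simp: canonical_embedding_def dual_add_mem dual_scale_mem)
qed

text \<open>
  A multiple of \<open>\<Phi>\<close> is again an eigenfunctional that vanishes at the character, so its Arens
  product with itself is zero.
\<close>

lemma eigenfunctional_in_radical:
  assumes \<Phi>: "eigenfunctional z \<Phi>" and z: "z \<noteq> 0" "\<And>n. cmod z powi n \<le> \<omega> n"
    and ker: "\<Phi> (character z) = 0"
  shows "\<Phi> \<in> jacobson_radical (bidual_alg A)"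
proof -
  let ?B = "bidual_alg A"
  have mem: "\<Phi> \<in> carrier ?B" using \<Phi> by (simp add: eigenfunctional_def)
  have "quasi_nilpotent ?B (\<Psi> \<otimes>\<^bsub>?B\<^esub> \<Phi>)" if \<Psi>: "\<Psi> \<in> carrier ?B" for \<Psi>
  proof -
    define \<Theta> where "\<Theta> = (\<lambda>l. \<Psi> (character z) * \<Phi> l)"
    have prod: "\<Psi> \<otimes>\<^bsub>?B\<^esub> \<Phi> = \<Theta>"
      using eigenfunctional_arens[OF \<Phi> z \<Psi>] by (simp add: bidual_alg_simps \<Theta>_def)
    have \<Theta>: "eigenfunctional z \<Theta>"
      using \<Phi> bidual_scale_mem[OF mem] by (auto simp: eigenfunctional_def \<Theta>_def)
    have \<Theta>_mem: "\<Theta> \<in> carrier ?B" using \<Theta> by (simp add: eigenfunctional_def)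
    have one_mem: "\<one>\<^bsub>?B\<^esub> \<in> carrier ?B"
      unfolding bidual_alg_simps by (rule embedding_mem[OF delta_mem])
    \<comment> \<open>The first power is by definition the unit times \<open>\<Theta>\<close>.\<close>
    have unit: "\<one>\<^bsub>?B\<^esub> \<otimes>\<^bsub>?B\<^esub> \<Theta> = \<Theta>"
      using eigenfunctional_arens[OF \<Theta> z one_mem] character_mem[OF z(2)]
      by (simp add: bidual_alg_simps canonical_embedding_def character_def pairing_delta)
    have zero: "X \<otimes>\<^bsub>?B\<^esub> \<Theta> = (\<lambda>_. 0)" if "X \<in> carrier ?B" "X (character z) = 0" for X
      using eigenfunctional_arens[OF \<Theta> z that(1)] that(2) by (simp add: bidual_alg_simps)
    have zero_in: "(\<lambda>_. 0) \<in> carrier ?B" using bidual_scale_mem[OF mem, of 0] by simp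
    have pow: "\<Theta> [^]\<^bsub>?B\<^esub> Suc (Suc n) = (\<lambda>_. 0)" for n :: nat
    proof (induction n)
      case 0
      have "\<Theta> (character z) = 0" by (simp add: \<Theta>_def ker)
    then show ?case using unit zero[OF \<Theta>_mem] by (simp only: nat_pow_def nat.rec)
    next
      case (Suc n)
      then show ?case using zero[OF zero_in] by (simp only: nat_pow_def nat.rec)
    qed
    have "root n (nrm ?B (\<Theta> [^]\<^bsub>?B\<^esub> n)) = 0" if "2 \<le> n" for n :: nat
    proof -
      obtain m where "n = Suc (Suc m)" using le_Suc_ex[OF \<open>2 \<le> n\<close>] by auto
      then show ?thesis
        using pow[of m] function_norm.dual_norm_zero[OF dual_function_norm]
        by (simp add: bidual_alg_simps)
    qed
    then have "\<forall>\<^sub>F n in sequentially. root n (nrm ?B (\<Theta> [^]\<^bsub>?B\<^esub> n)) = 0"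
      unfolding eventually_sequentially by blast
    then show ?thesis unfolding prod quasi_nilpotent_def by (rule tendsto_eventually)
  qed
  then show ?thesis using mem by (simp add: jacobson_radical_def)
qed

text \<open>
  The function \<open>\<lambda>n. f k (n - 1) - z * f k n\<close> is \<open>\<delta>\<^sub>1 * f k - z f k\<close>. Approximate eigenvectors may
  well converge weakly to 0; the functional \<open>l\<close> is there to exclude this.
\<close>

lemma radical_nonzero_if_approximate_eigenvectors:
  assumes z: "z \<noteq> 0" "\<And>n. cmod z powi n \<le> \<omega> n"
    and f: "\<And>k::nat. f k \<in> V" "\<And>k. N (f k) \<le> C"
    and eigen: "(\<lambda>k. N (\<lambda>n. f k (n - 1) - z * f k n)) \<longlonglongrightarrow> 0"
    and ker: "(\<lambda>k. character z (f k)) \<longlonglongrightarrow> 0"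
    and l: "l \<in> dual A" "(\<lambda>k. l (f k)) \<longlonglongrightarrow> c" "c \<noteq> 0"
  shows "jacobson_radical (bidual_alg A) \<noteq> {\<lambda>_. 0}"
proof -
  obtain \<Phi> where \<Phi>: "\<Phi> \<in> carrier (bidual_alg A)"
    and lim: "\<And>l c. l \<in> dual A \<Longrightarrow> (\<lambda>k. l (f k)) \<longlonglongrightarrow> c \<Longrightarrow> \<Phi> l = c"
    by (rule bounded_sequence_cluster_functional[of f C, OF f]) (rule that, simp_all add: bidual_carrier)
  have "\<Phi> (dual_act A l (\<delta> 1)) = z * \<Phi> l" if l: "l \<in> dual A" for l
  proof -
    let ?l1 = "dual_act A l (\<delta> 1)" and ?l2 = "\<lambda>b. - z * l b"
    have l12: "?l1 \<in> dual A" "?l2 \<in> dual A"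
      by (rule dual_act_mem[OF l delta_mem], rule dual_scale_mem[OF l])
    let ?d = "\<lambda>b. ?l1 b + ?l2 b"
    have "cmod (?d (f k)) \<le> dual_norm V N l * N (\<lambda>n. f k (n - 1) - z * f k n)" for k
    proof -
      have s: "(\<lambda>n. f k (n - 1)) \<in> V" "(\<lambda>n. - z * f k n) \<in> V"
        using mult_mem[OF delta_mem f(1), of 1 k] scale_mem[OF f(1)] by (simp only: delta_mult, blast)
      have "?d (f k) = l (\<lambda>n. f k (n - 1) + - z * f k n)"
        using dual_add[OF l s] dual_scale[OF l f(1), of "- z"] f(1) by (simp add: dual_act_def delta_mult)
      then show ?thesis using dual_norm_upper[OF l add_mem[OF s]] by simp
    qed
    moreover have "(\<lambda>k. dual_norm V N l * N (\<lambda>n. f k (n - 1) - z * f k n)) \<longlonglongrightarrow> 0"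
      by (rule tendsto_mult_right_zero[OF eigen])
    ultimately have "(\<lambda>k. ?d (f k)) \<longlonglongrightarrow> 0"
      by (intro Lim_null_comparison[of "\<lambda>k. ?d (f k)"]) auto
    then have "\<Phi> ?d = 0" by (rule lim[OF dual_add_mem[OF l12]])
    then show ?thesis using bidual_add[OF \<Phi> l12] bidual_scale[OF \<Phi> l, of "- z"] by simp
  qed
  then have "eigenfunctional z \<Phi>" using \<Phi> by (simp add: eigenfunctional_def)
  moreover have "\<Phi> (character z) = 0" by (rule lim[OF character_mem[OF z(2)] ker])
  ultimately have "\<Phi> \<in> jacobson_radical (bidual_alg A)"
    by (rule eigenfunctional_in_radical[OF _ z])
  moreover have "\<Phi> \<noteq> (\<lambda>_. 0)" using lim[OF l(1,2)] l(3) by auto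
  ultimately show ?thesis by auto
qed

section \<open>The growth rate of the weight\<close>

text \<open>
  By submultiplicativity this is the limit of \<open>\<omega> n\<close> to the power \<open>1/n\<close> as \<open>n \<longrightarrow> \<infinity>\<close>. As a supremum, it
  directly yields the two facts that matter: the lower bound for \<open>\<omega>\<close>, and its failure for every
  larger \<open>t\<close>.
\<close>

definition growth_rate :: real where
  "growth_rate = Sup {t. 1 \<le> t \<and> (\<forall>n::nat. t ^ n \<le> \<omega> (int n))}"

lemma
  shows growth_rate_ge_1: "1 \<le> growth_rate"
    and growth_rate_le: "growth_rate ^ n \<le> \<omega> (int n)"
    and growth_rate_exceeded: "growth_rate < t \<Longrightarrow> \<exists>m. \<omega> (int m) < t ^ m"
proof -
  let ?T = "{t. 1 \<le> t \<and> (\<forall>n::nat. t ^ n \<le> \<omega> (int n))}"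
  have one: "1 \<in> ?T" using weight_ge_1 by auto
  have bdd: "bdd_above ?T"
  proof (rule bdd_aboveI)
    fix t assume "t \<in> ?T"
    then have "t ^ 1 \<le> \<omega> (int 1)" by blast
    then show "t \<le> \<omega> 1" by simp
  qed
  show ge: "1 \<le> growth_rate" unfolding growth_rate_def by (rule cSup_upper[OF one bdd])
  show "growth_rate ^ n \<le> \<omega> (int n)"
  proof (cases "n = 0")
    case True
    then show ?thesis by (simp add: weight_0)
  next
    case False
    have "growth_rate \<le> root n (\<omega> (int n))" unfolding growth_rate_def
    proof (rule cSup_least)
      fix t assume "t \<in> ?T"
      then have "root n (t ^ n) \<le> root n (\<omega> (int n))" "0 \<le> t" using False by auto
      then show "t \<le> root n (\<omega> (int n))" using False by (simp add: real_root_power_cancel)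
    qed (use one in blast)
    then have "growth_rate ^ n \<le> root n (\<omega> (int n)) ^ n"
      using ge by (intro power_mono) auto
    then show ?thesis using False by simp
  qed
  show "\<exists>m. \<omega> (int m) < t ^ m" if "growth_rate < t"
  proof (rule ccontr)
    assume "\<not> ?thesis"
    then have "t \<in> ?T" using that ge by (auto simp: not_less)
    then have "t \<le> growth_rate" unfolding growth_rate_def by (rule cSup_upper[OF _ bdd])
    then show False using that by simp
  qed
qed

lemma growth_rate_pos [simp]: "0 < growth_rate"
  using growth_rate_ge_1 by linarith

lemma growth_rate_nonzero [simp]: "growth_rate \<noteq> 0" "\<bar>growth_rate\<bar> = growth_rate" "0 \<le> growth_rate"
  using growth_rate_pos by linarith+

lemma growth_rate_powi_le: "growth_rate powi n \<le> \<omega> n"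
proof (cases "0 \<le> n")
  case True
  then show ?thesis using growth_rate_le[of "nat n"] by (simp add: power_int_def)
next
  case False
  have "growth_rate powi n \<le> 1"
    using False growth_rate_ge_1 power_le_one[of "inverse growth_rate" "nat (- n)"]
    by (simp add: power_int_def inverse_le_1_iff)
  then show ?thesis using weight_ge_1[of n] by linarith
qed

definition reduced_weight :: "nat \<Rightarrow> real" where
  "reduced_weight n = \<omega> (int n) / growth_rate ^ n"

definition reduced_sum :: "nat \<Rightarrow> real" where
  "reduced_sum n = (\<Sum>i<n. reduced_weight i)"

lemma reduced_weight_ge_1: "1 \<le> reduced_weight n"
  using growth_rate_le[of n] by (simp add: reduced_weight_def)

lemma reduced_sum_ge: "real n \<le> reduced_sum n"
  using sum_mono[of "{..<n}" "\<lambda>_. 1" reduced_weight] reduced_weight_ge_1 by (simp add: reduced_sum_def)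

lemma weight_power_le: "\<omega> (int (k * m)) \<le> \<omega> (int m) ^ k"
proof (induction k)
  case (Suc k)
  have "\<omega> (int (Suc k * m)) \<le> \<omega> (int m) * \<omega> (int (k * m))"
    using weight_mult[of "int m" "int (k * m)"] by simp
  also have "\<dots> \<le> \<omega> (int m) * \<omega> (int m) ^ k" using Suc by (intro mult_left_mono) auto
  finally show ?case by simp
qed (simp add: weight_0)

text \<open>
  If \<open>\<eta> n \<ge> \<epsilon> S n\<close> for all large \<open>n\<close>, then \<open>S\<close> and hence \<open>\<eta>\<close> grow at least like \<open>(1 + \<epsilon>)^n\<close>, so \<open>\<omega>\<close>
  grows at least like \<open>(\<rho> (1 + \<epsilon>))^n\<close>. But a single \<open>m\<close> with \<open>\<omega> m < (\<rho> (1 + \<epsilon>))^m\<close>, which exists as \<open>\<rho>\<close> is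
  the growth rate, makes \<open>\<omega>\<close> exponentially smaller than that along the multiples of \<open>m\<close>.
\<close>

lemma reduced_weight_slow:
  assumes \<epsilon>: "0 < \<epsilon>"
  shows "\<exists>n\<ge>N\<^sub>0. reduced_weight n < \<epsilon> * reduced_sum n"
proof (rule ccontr)
  assume "\<not> ?thesis"
  then have fast: "\<epsilon> * reduced_sum n \<le> reduced_weight n" if "n \<ge> N\<^sub>0" for n
    using that by (auto simp: not_less)
  \<comment> \<open>A positive starting index, so that the partial sum there is at least 1.\<close>
  define K where "K = Suc N\<^sub>0"
  have sum_grows: "(1 + \<epsilon>) ^ j \<le> reduced_sum (K + j)" for j
  proof (induction j)
    case 0
    show ?case using reduced_sum_ge[of K] by (simp add: K_def)
  next
    case (Suc j)
    have "(1 + \<epsilon>) ^ Suc j \<le> (1 + \<epsilon>) * reduced_sum (K + j)" using Suc \<epsilon> by simp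
    also have "\<dots> \<le> reduced_sum (K + Suc j)"
      using fast[of "K + j"] by (simp add: K_def reduced_sum_def algebra_simps)
    finally show ?case .
  qed
  have "growth_rate < growth_rate * (1 + \<epsilon>)" using \<epsilon> by simp
  then obtain m where m: "\<omega> (int m) < (growth_rate * (1 + \<epsilon>)) ^ m"
    using growth_rate_exceeded by blast
  have m_pos: "0 < m" using m weight_0 by (cases m) auto
  define q where "q = \<omega> (int m) / (growth_rate * (1 + \<epsilon>)) ^ m"
  have T_pos: "0 < (growth_rate * (1 + \<epsilon>)) ^ m" using \<epsilon> by (intro zero_less_power mult_pos_pos) auto
  have q: "0 \<le> q" "q < 1" using m T_pos by (auto simp: q_def)
  define c where "c = \<epsilon> / (1 + \<epsilon>) ^ K"
  have c: "0 < c" using \<epsilon> by (simp add: c_def)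
  have "c \<le> q ^ k" if k: "K \<le> k" for k
  proof -
    have km: "K \<le> k * m" using k m_pos by (cases m) auto
    have "c * (1 + \<epsilon>) ^ (k * m) = \<epsilon> * (1 + \<epsilon>) ^ (k * m - K)"
      using \<epsilon> km by (simp add: c_def power_diff)
    also have "\<dots> \<le> \<epsilon> * reduced_sum (k * m)"
      using sum_grows[of "k * m - K"] km \<epsilon> by simp
    also have "\<dots> \<le> reduced_weight (k * m)" using fast[of "k * m"] km by (simp add: K_def)
    also have "\<dots> \<le> \<omega> (int m) ^ k / growth_rate ^ (k * m)"
      unfolding reduced_weight_def using weight_power_le by (intro divide_right_mono) auto
    also have "\<dots> = q ^ k * (1 + \<epsilon>) ^ (k * m)"
      using \<epsilon> by (simp add: q_def power_divide power_mult_distrib power_mult[symmetric] mult.commute[of m k])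
    finally show ?thesis using \<epsilon> by simp
  qed
  moreover obtain k where "q ^ k < c" using real_arch_pow_inv[OF c q(2)] by blast
  moreover have "q ^ max k K \<le> q ^ k" using q by (intro power_decreasing) auto
  ultimately show False by (metis max.cobounded2 not_less order_trans)
qed

section \<open>Geometric blocks as approximate eigenvectors\<close>

definition shift_defect :: "(int \<Rightarrow> complex) \<Rightarrow> int \<Rightarrow> complex" where
  "shift_defect f = (\<lambda>n. f (n - 1) - complex_of_real growth_rate * f n)"

lemma shift_defect_mem: "f \<in> V \<Longrightarrow> shift_defect f \<in> V"
  using add_mem[OF mult_mem[OF delta_mem, of f 1] scale_mem[of f "- complex_of_real growth_rate"]]
  by (simp add: shift_defect_def delta_mult)

definition block :: "nat \<Rightarrow> int \<Rightarrow> complex" where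
  "block M n = (if 0 \<le> n \<and> n < int M then complex_of_real (1 / growth_rate ^ nat n) else 0)"

lemma block_outside: "n \<notin> int ` {..<M} \<Longrightarrow> block M n = 0"
proof (rule ccontr)
  assume n: "n \<notin> int ` {..<M}" and "block M n \<noteq> 0"
  then have "0 \<le> n" "n < int M" by (auto simp: block_def split: if_splits)
  then have "n = int (nat n)" "nat n \<in> {..<M}" by auto
  then show False using n by blast
qed

lemma block_mem: "block M \<in> V"
  by (rule finite_support_mem[of "int ` {..<M}", OF _ block_outside]) auto

lemma block_norm: "N (block M) = reduced_sum M"
  by (subst finite_support_mem(2)[of "int ` {..<M}", OF _ block_outside])
    (auto simp: sum.reindex block_def reduced_sum_def reduced_weight_def norm_divide norm_power)

lemma block_pairing: "pairing w (block M) = (\<Sum>i<M. w (int i) / complex_of_real growth_rate ^ i)"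
  by (subst pairing_finite_support[of "int ` {..<M}", OF _ block_outside])
    (auto simp: sum.reindex block_def)

lemma block_character: "character (complex_of_real growth_rate) (block M) = of_nat M"
  unfolding character_def block_pairing by simp

text \<open>
  The entries of a block are scaled so that multiplying by \<open>\<rho>\<close> and shifting agree on them: only the
  two boundary terms at \<open>0\<close> and \<open>M\<close> survive.
\<close>

lemma block_shift_defect:
  assumes M: "1 \<le> M"
  shows "N (shift_defect (block M)) \<le> 2 * growth_rate * reduced_weight M"
proof -
  let ?r = "complex_of_real growth_rate"
  have eq: "shift_defect (block M) = (\<lambda>n. (if n = int M then ?r / ?r ^ M else 0) - (if n = 0 then ?r else 0))"
  proof
    fix n
    consider "n < 0" | "n = 0" | "0 < n" "n < int M" | "n = int M" | "int M < n" by linarith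
    then show "shift_defect (block M) n = (if n = int M then ?r / ?r ^ M else 0) - (if n = 0 then ?r else 0)"
    proof cases
      case 3
      then have "nat n = Suc (nat (n - 1))" by simp
      then show ?thesis using 3 by (simp add: shift_defect_def block_def)
    next
      case 4
      obtain m where "M = Suc m" using M by (cases M) auto
      then show ?thesis using 4 by (simp add: shift_defect_def block_def)
    qed (use M in \<open>auto simp: shift_defect_def block_def\<close>)
  qed
  have "N (shift_defect (block M)) = (\<Sum>n\<in>{0, int M}. cmod (shift_defect (block M) n) * \<omega> n)"
    by (rule finite_support_mem) (auto simp: eq)
  also have "\<dots> = growth_rate * (1 + reduced_weight M)"
    using M by (simp add: eq norm_divide norm_power weight_0 reduced_weight_def algebra_simps)
  also have "\<dots> \<le> growth_rate * (2 * reduced_weight M)"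
    using reduced_weight_ge_1[of M] by (intro mult_left_mono) auto
  finally show ?thesis by simp
qed

lemma radical_nonzero_at_growth_rate:
  assumes f: "\<And>k::nat. f k \<in> V" "\<And>k. N (f k) \<le> C"
    and eigen: "(\<lambda>k. N (shift_defect (f k))) \<longlonglongrightarrow> 0"
    and ker: "(\<lambda>k. character (complex_of_real growth_rate) (f k)) \<longlonglongrightarrow> 0"
    and l: "l \<in> dual A" "(\<lambda>k. l (f k)) \<longlonglongrightarrow> c" "c \<noteq> 0"
  shows "jacobson_radical (bidual_alg A) \<noteq> {\<lambda>_. 0}"
proof (rule radical_nonzero_if_approximate_eigenvectors[OF _ _ f _ ker l])
  show "complex_of_real growth_rate \<noteq> 0" using growth_rate_pos by (metis less_irrefl of_real_eq_0_iff)
  show "cmod (complex_of_real growth_rate) powi n \<le> \<omega> n" for n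
    using growth_rate_powi_le[of n] by simp
  show "(\<lambda>k. N (\<lambda>n. f k (n - 1) - complex_of_real growth_rate * f k n)) \<longlonglongrightarrow> 0"
    using eigen by (simp add: shift_defect_def)
qed

lemma character_dual: "character (complex_of_real growth_rate) \<in> dual A"
  by (rule character_mem) (use growth_rate_powi_le in simp)

lemma shift_defect_scale: "shift_defect (\<lambda>n. c * f n) = (\<lambda>n. c * shift_defect f n)"
  by (auto simp: shift_defect_def algebra_simps)

lemma shift_defect_add: "shift_defect (\<lambda>n. f n + g n) = (\<lambda>n. shift_defect f n + shift_defect g n)"
  by (auto simp: shift_defect_def algebra_simps)

lemma tendsto_0_inverse_Suc: "(\<lambda>k. C / real (Suc k)) \<longlonglongrightarrow> 0"
  using tendsto_mult_right_zero[OF LIMSEQ_inverse_real_of_nat, of C] by (simp add: divide_inverse)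

text \<open>
  The blocks normalised in \<open>N\<close>. They do not converge weakly to 0 because all their entries are
  nonnegative, so that the functional with coefficients \<open>\<omega>\<close> evaluates to their norm.
\<close>

lemma radical_nonzero_if_sparse:
  assumes "\<And>\<epsilon>. 0 < \<epsilon> \<Longrightarrow> \<exists>M\<ge>1. reduced_weight M < \<epsilon> * reduced_sum M \<and> real M < \<epsilon> * reduced_sum M"
  shows "jacobson_radical (bidual_alg A) \<noteq> {\<lambda>_. 0}"
proof -
  have "\<exists>M\<ge>1. reduced_weight M < 1 / real (Suc k) * reduced_sum M \<and> real M < 1 / real (Suc k) * reduced_sum M" for k
    by (rule assms) simp
  then obtain M where M: "\<And>k. 1 \<le> M k" "\<And>k. reduced_weight (M k) < 1 / real (Suc k) * reduced_sum (M k)"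
    "\<And>k. real (M k) < 1 / real (Suc k) * reduced_sum (M k)" by metis
  have S: "0 < reduced_sum (M k)" for k using reduced_sum_ge[of "M k"] M(1)[of k] by linarith
  define c where "c k = complex_of_real (1 / reduced_sum (M k))" for k
  have c: "cmod (c k) = 1 / reduced_sum (M k)" for k using S[of k] by (simp add: c_def norm_divide)
  define f where "f k = (\<lambda>n. c k * block (M k) n)" for k
  have f: "f k \<in> V" for k unfolding f_def by (rule scale_mem[OF block_mem])
  have N_f: "N (f k) = 1" for k
    using S[of k] unfolding f_def norm_scale[OF block_mem] block_norm c by simp
  have "N (shift_defect (f k)) \<le> 2 * growth_rate / real (Suc k)" for k
  proof -
    have "N (shift_defect (f k)) \<le> 1 / reduced_sum (M k) * (2 * growth_rate * reduced_weight (M k))"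
      unfolding f_def shift_defect_scale norm_scale[OF shift_defect_mem[OF block_mem]] c
      using S[of k] block_shift_defect[OF M(1)[of k]] by (intro mult_left_mono) auto
    also have "\<dots> \<le> 1 / reduced_sum (M k) * (2 * growth_rate * (1 / real (Suc k) * reduced_sum (M k)))"
      using S[of k] M(2)[of k] growth_rate_pos by (intro mult_left_mono) auto
    finally show ?thesis using S[of k] by simp
  qed
  then have eigen: "(\<lambda>k. N (shift_defect (f k))) \<longlonglongrightarrow> 0"
    by (intro Lim_null_comparison[OF _ tendsto_0_inverse_Suc[of "2 * growth_rate"]] always_eventually)
      (simp add: norm_nonneg[OF shift_defect_mem[OF f]])
  have char: "character (complex_of_real growth_rate) (f k) = complex_of_real (real (M k) / reduced_sum (M k))" for k
    unfolding f_def dual_scale[OF character_dual block_mem] block_character by (simp add: c_def)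
  have "real (M k) / reduced_sum (M k) \<le> 1 / real (Suc k)" for k
    using M(3)[of k] S[of k] by (simp add: field_simps)
  then have ker: "(\<lambda>k. character (complex_of_real growth_rate) (f k)) \<longlonglongrightarrow> 0"
    using S unfolding char
    by (intro Lim_null_comparison[OF _ tendsto_0_inverse_Suc[of 1]] always_eventually)
      (simp add: norm_divide less_imp_le)
  let ?l = "pairing (\<lambda>n. complex_of_real (\<omega> n))"
  have l: "?l \<in> dual A" by (rule pairing_mem) simp
  have "?l (block m) = complex_of_real (reduced_sum m)" for m
    by (simp add: block_pairing reduced_sum_def reduced_weight_def)
  then have "?l (f k) = 1" for k
    using S[of k] unfolding f_def dual_scale[OF l block_mem] by (simp add: c_def)
  then show ?thesis
    by (intro radical_nonzero_at_growth_rate[OF f _ eigen ker l, of 1 1]) (simp_all add: N_f)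
qed

text \<open>
  Take \<open>s\<close> constant with alternating signs on the successive blocks \<open>{M k..<M (Suc k)}\<close>. Each block is
  so much longer than everything before it that the average up to its end is nearly the sign on it.
\<close>

lemma lacunary_averages_oscillate:
  fixes M :: "nat \<Rightarrow> nat"
  assumes M: "\<And>k. 1 \<le> M k" "\<And>k. Suc k * M k \<le> M (Suc k)"
  obtains s :: "nat \<Rightarrow> real" where "\<And>n. \<bar>s n\<bar> \<le> 1"
    and "\<And>k. \<bar>(\<Sum>i<M (Suc k). s i) / real (M (Suc k)) - (-1) ^ k\<bar> \<le> 2 / real (Suc k)"
proof -
  define s :: "nat \<Rightarrow> real" where "s n = - ((-1) ^ (LEAST k. n < M k))" for n
  have s1: "\<bar>s n\<bar> = 1" for n by (simp add: s_def)
  have step: "M k \<le> M (Suc k)" for k using M(2)[of k] by simp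
  have mono: "i \<le> j \<Longrightarrow> M i \<le> M j" for i j using lift_Suc_mono_le[of M] step by blast
  have s_block: "s n = (-1) ^ k" if "M k \<le> n" "n < M (Suc k)" for n k
  proof -
    have "(LEAST j. n < M j) = Suc k"
    proof (rule Least_equality)
      fix j assume "n < M j"
      then have "\<not> j \<le> k" using mono[of j k] that(1) by linarith
      then show "Suc k \<le> j" by simp
    qed (rule that(2))
    then show ?thesis by (simp add: s_def)
  qed
  have "\<bar>(\<Sum>i<M (Suc k). s i) / real (M (Suc k)) - (-1) ^ k\<bar> \<le> 2 / real (Suc k)" for k
  proof -
    let ?m = "real (M k)" and ?m' = "real (M (Suc k))"
    have pos: "0 < ?m'" using M(1)[of "Suc k"] by simp
    have "(\<Sum>i<M (Suc k). s i) = (\<Sum>i<M k. s i) + (\<Sum>i=M k..<M (Suc k). s i)"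
      using step[of k] by (metis lessThan_atLeast0 sum.atLeastLessThan_concat zero_le)
    also have "(\<Sum>i=M k..<M (Suc k). s i) = (\<Sum>i=M k..<M (Suc k). (-1) ^ k)"
      by (rule sum.cong) (auto simp: s_block)
    also have "\<dots> = (?m' - ?m) * (-1) ^ k" using step[of k] by (simp add: of_nat_diff)
    finally have "(\<Sum>i<M (Suc k). s i) - ?m' * (-1) ^ k = (\<Sum>i<M k. s i) - ?m * (-1) ^ k"
      by (simp add: algebra_simps)
    also have "\<bar>\<dots>\<bar> \<le> ?m + ?m"
    proof -
      have "\<bar>\<Sum>i<M k. s i\<bar> \<le> (\<Sum>i<M k. \<bar>s i\<bar>)" by (rule sum_abs)
      moreover have "(\<Sum>i<M k. \<bar>s i\<bar>) = ?m" by (simp add: s1)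
      moreover have "\<bar>?m * (-1) ^ k\<bar> = ?m" by (simp add: abs_mult)
      ultimately show ?thesis by linarith
    qed
    finally have "\<bar>(\<Sum>i<M (Suc k). s i) - ?m' * (-1) ^ k\<bar> / ?m' \<le> 2 * ?m / ?m'"
      using pos by (simp add: divide_right_mono)
    moreover have "\<bar>(\<Sum>i<M (Suc k). s i) - ?m' * (-1) ^ k\<bar> / ?m' = \<bar>(\<Sum>i<M (Suc k). s i) / ?m' - (-1) ^ k\<bar>"
    proof -
      have "((\<Sum>i<M (Suc k). s i) - ?m' * (-1) ^ k) / ?m' = (\<Sum>i<M (Suc k). s i) / ?m' - (-1) ^ k"
        using pos by (simp add: diff_divide_distrib)
      then show ?thesis using pos by (metis abs_divide abs_of_pos)
    qed
    moreover have "2 * ?m / ?m' \<le> 2 / real (Suc k)"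
    proof -
      have "real (Suc k * M k) \<le> ?m'" using M(2)[of k] of_nat_le_iff by blast
      then show ?thesis using pos by (simp add: field_simps)
    qed
    ultimately show ?thesis by linarith
  qed
  then show ?thesis using s1 that[of s] by simp
qed

text \<open>
  The indices \<open>M k\<close> are chosen to grow lacunarily and to have ever smaller shift defects. The
  hypothesis bounds the averages \<open>g k\<close> of the blocks, and \<open>f k\<close> is the difference of two consecutive
  ones: the character takes the value 1 at both and cancels, while the oscillating functional
  takes values close to \<open>1\<close> and \<open>-1\<close>.
\<close>

lemma radical_nonzero_if_bounded_averages:
  assumes \<epsilon>: "0 < \<epsilon>"
    and bounded: "\<And>M. 1 \<le> M \<Longrightarrow> reduced_weight M < \<epsilon> * reduced_sum M \<Longrightarrow> \<epsilon> * reduced_sum M \<le> real M"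
  shows "jacobson_radical (bidual_alg A) \<noteq> {\<lambda>_. 0}"
proof -
  \<comment> \<open>Dividing by \<open>Suc k\<close> makes the defects vanish in the limit and keeps the smallness that the
    hypothesis asks for.\<close>
  let ?P = "\<lambda>k M. 1 \<le> M \<and> reduced_weight M < \<epsilon> / real (Suc k) * reduced_sum M"
  have "\<exists>M. \<forall>k. ?P k (M k) \<and> Suc k * M k \<le> M (Suc k)"
  proof (rule dependent_nat_choice)
    show "\<exists>M. ?P 0 M" using reduced_weight_slow[of "\<epsilon> / real (Suc 0)" 1] \<epsilon> by auto
    show "\<exists>M'. ?P (Suc k) M' \<and> Suc k * M \<le> M'" for M k
      using reduced_weight_slow[of "\<epsilon> / real (Suc (Suc k))" "max 1 (Suc k * M)"] \<epsilon>
      by (metis divide_pos_pos max.bounded_iff of_nat_0_less_iff zero_less_Suc)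
  qed
  then obtain M where M: "\<And>k. 1 \<le> M k" "\<And>k. reduced_weight (M k) < \<epsilon> / real (Suc k) * reduced_sum (M k)"
    "\<And>k. Suc k * M k \<le> M (Suc k)" by auto
  have S: "0 < reduced_sum (M k)" for k using reduced_sum_ge[of "M k"] M(1)[of k] by linarith
  have S_le: "\<epsilon> * reduced_sum (M k) \<le> real (M k)" for k
  proof (rule bounded[OF M(1)])
    have "\<epsilon> / real (Suc k) * reduced_sum (M k) \<le> \<epsilon> / 1 * reduced_sum (M k)"
      using \<epsilon> S[of k] by (intro mult_right_mono divide_left_mono) auto
    then show "reduced_weight (M k) < \<epsilon> * reduced_sum (M k)" using M(2)[of k] by simp
  qed
  obtain s :: "nat \<Rightarrow> real" where s: "\<And>n. \<bar>s n\<bar> \<le> 1"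
    "\<And>k. \<bar>(\<Sum>i<M (Suc k). s i) / real (M (Suc k)) - (-1) ^ k\<bar> \<le> 2 / real (Suc k)"
    using lacunary_averages_oscillate[of M, OF M(1,3)] by blast
  define c where "c k = complex_of_real (1 / real (M k))" for k
  have c: "cmod (c k) = 1 / real (M k)" for k by (simp add: c_def norm_divide)
  have M_pos: "0 < real (M k)" for k using M(1)[of k] by simp
  define g where "g k = (\<lambda>n. c k * block (M k) n)" for k
  have g: "g k \<in> V" for k unfolding g_def by (rule scale_mem[OF block_mem])
  have N_g: "N (g k) \<le> 1 / \<epsilon>" for k
    using S_le[of k] M_pos[of k] \<epsilon> unfolding g_def norm_scale[OF block_mem] block_norm c
    by (simp add: field_simps)
  have g_defect: "N (shift_defect (g k)) \<le> 2 * growth_rate / real (Suc k)" for k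
  proof -
    have "N (shift_defect (g k)) \<le> 1 / real (M k) * (2 * growth_rate * reduced_weight (M k))"
      unfolding g_def shift_defect_scale norm_scale[OF shift_defect_mem[OF block_mem]] c
      using block_shift_defect[OF M(1)[of k]] by (intro mult_left_mono) auto
    also have "\<dots> \<le> 1 / real (M k) * (2 * growth_rate * (real (M k) / real (Suc k)))"
    proof -
      have "reduced_weight (M k) \<le> real (M k) / real (Suc k)"
        using M(2)[of k] S_le[of k] divide_right_mono[OF S_le[of k], of "real (Suc k)"] by simp
      then show ?thesis using growth_rate_pos by (intro mult_left_mono) auto
    qed
    finally show ?thesis using M_pos[of k] by simp
  qed
  let ?l = "pairing (\<lambda>n. if 0 \<le> n then complex_of_real (s (nat n) * growth_rate ^ nat n) else 0)"
  have l: "?l \<in> dual A"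
  proof (rule pairing_mem)
    fix n
    show "cmod (if 0 \<le> n then complex_of_real (s (nat n) * growth_rate ^ nat n) else 0) \<le> \<omega> n"
    proof (cases "0 \<le> n")
      case True
      have "\<bar>s (nat n)\<bar> * growth_rate ^ nat n \<le> 1 * growth_rate ^ nat n"
        using s(1)[of "nat n"] by (intro mult_right_mono) auto
      also have "\<dots> \<le> \<omega> n" using True growth_rate_le[of "nat n"] by simp
      finally show ?thesis using True by (simp add: norm_mult norm_power)
    qed simp
  qed
  have l_g: "?l (g k) = complex_of_real ((\<Sum>i<M k. s i) / real (M k))" for k
    unfolding g_def dual_scale[OF l block_mem] by (simp add: block_pairing c_def)
  \<comment> \<open>The average over the first \<open>M (Suc j)\<close> indices is close to \<open>(-1) ^ j\<close>, so the one with index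
    \<open>Suc (2 * k)\<close> contributes \<open>1\<close> and the subtracted one \<open>-1\<close>; the limit is 2.\<close>
  define f where "f k = (\<lambda>n. g (Suc (2 * k)) n + - 1 * g (Suc (Suc (2 * k))) n)" for k
  have neg: "(\<lambda>n. - 1 * g k n) \<in> V" for k by (rule scale_mem[OF g])
  have N_neg: "N (\<lambda>n. - 1 * h n) = N h" if "h \<in> V" for h using norm_scale[OF that, of "- 1"] by simp
  have f: "f k \<in> V" for k unfolding f_def by (rule add_mem[OF g neg])
  have N_f: "N (f k) \<le> 2 / \<epsilon>" for k
    using N_add[OF g neg, of "Suc (2 * k)" "Suc (Suc (2 * k))"] N_g[of "Suc (2 * k)"] N_g[of "Suc (Suc (2 * k))"]
    unfolding f_def N_neg[OF g] by simp
  have "N (shift_defect (f k)) \<le> 4 * growth_rate / real (Suc k)" for k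
  proof -
    have "N (shift_defect (f k)) \<le> N (shift_defect (g (Suc (2 * k)))) + N (shift_defect (g (Suc (Suc (2 * k)))))"
      using N_add[OF shift_defect_mem[OF g] scale_mem[OF shift_defect_mem[OF g], of "- 1"]]
      unfolding f_def shift_defect_add shift_defect_scale N_neg[OF shift_defect_mem[OF g]] .
    also have "\<dots> \<le> 2 * growth_rate / real (Suc k) + 2 * growth_rate / real (Suc k)"
      by (intro add_mono order_trans[OF g_defect] divide_left_mono) (use growth_rate_pos in auto)
    finally show ?thesis by simp
  qed
  then have eigen: "(\<lambda>k. N (shift_defect (f k))) \<longlonglongrightarrow> 0"
    by (intro Lim_null_comparison[OF _ tendsto_0_inverse_Suc[of "4 * growth_rate"]] always_eventually)
      (simp add: norm_nonneg[OF shift_defect_mem[OF f]])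
  have char_g: "character (complex_of_real growth_rate) (g k) = 1" for k
    using M_pos[of k] unfolding g_def dual_scale[OF character_dual block_mem] block_character by (simp add: c_def)
  have ker: "character (complex_of_real growth_rate) (f k) = 0" for k
    unfolding f_def dual_add[OF character_dual g neg] dual_scale[OF character_dual g] char_g by simp
  define a where "a k = (\<Sum>i<M k. s i) / real (M k)" for k
  have l_f: "?l (f k) = complex_of_real (a (Suc (2 * k)) - a (Suc (Suc (2 * k))))" for k
    unfolding f_def dual_add[OF l g neg] dual_scale[OF l g] l_g a_def by simp
  have "\<bar>a (Suc (2 * k)) - a (Suc (Suc (2 * k))) - 2\<bar> \<le> 4 / real (Suc k)" for k
  proof -
    have "2 / real (Suc (2 * k)) \<le> 2 / real (Suc k)" "2 / real (Suc (Suc (2 * k))) \<le> 2 / real (Suc k)"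
      by (intro divide_left_mono; simp)+
    then show ?thesis using s(2)[of "2 * k"] s(2)[of "Suc (2 * k)"] unfolding a_def[symmetric] by simp
  qed
  then have "(\<lambda>k. a (Suc (2 * k)) - a (Suc (Suc (2 * k))) - 2) \<longlonglongrightarrow> 0"
    by (intro Lim_null_comparison[OF _ tendsto_0_inverse_Suc[of 4]] always_eventually) simp
  then have "(\<lambda>k. a (Suc (2 * k)) - a (Suc (Suc (2 * k)))) \<longlonglongrightarrow> 2" by (simp add: LIM_zero_cancel)
  then have lim: "(\<lambda>k. ?l (f k)) \<longlonglongrightarrow> complex_of_real 2" unfolding l_f by (rule tendsto_of_real)
  show ?thesis
    by (rule radical_nonzero_at_growth_rate[OF f N_f eigen _ l lim]) (simp_all add: ker)
qed

end

theorem theorem1p1: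
  fixes \<omega> :: "int \<Rightarrow> real"
  assumes "weight \<omega>"
  shows "jacobson_radical (bidual_alg (l1_alg \<omega>)) \<noteq> {\<lambda>_. 0}"
proof -
  interpret beurling_algebra \<omega> by (rule beurling_algebra.intro[OF assms])
  show ?thesis
    using radical_nonzero_if_sparse radical_nonzero_if_bounded_averages by (meson not_less)
qed

end
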